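(* Let $\beta>0$, let $V:X\to\mathbb{R}$ be a continuous function, and let $c(x,y)=V(y)-V(x)$, $(x,y)\in G$, be the associated separable cocycle. Let $L_{-\beta V}$ be the separable Haar-Ruelle operator $$L_{-\beta V}(f)(x)=\frac1d\sum_{j=1}^{d}\ \sum_{s\in[j*x]} f(s)\,e^{-\beta V(s)},\qquad x\in X.$$ Let $M$ be a finite Borel measure on $X$ such that $L_{-\beta V}^{*}M=\lambda M$ for some $\lambda>0$. Then $M$ is $(c,\beta)$-quasi-invariant, that is, $$\int_X\sum_{s\in[x]} h(s,x)\,dM(x)=\int_X\sum_{s\in[x]} h(x,s)\,e^{-\beta (V(s)-V(x))}\,dM(x)$$ for every integrable function $h:G\to\mathbb{R}$.
   Context: Let $d\ge 1$ be an integer and $X=\{1,\dots,d\}^{\mathbb{N}}$, a compact metric space with the usual metric $d_X(x,z)=2^{-\min\{n\ge1:\ x_n\ne z_n\}}$ ($d_X(x,x)=0$). For $j\in\{1,\dots,d\}$ and $x=(x_1,x_2,\dots)\in X$ write $j*x=(j,x_1,x_2,\dots)$. Let $\sim$ be an equivalence relation on $X$ with finite classes $[x]=\{s\in X: s\sim x\}$, such that $x\mapsto[x]$ is hemicontinuous as a multivalued map. Let $G=\{(x,y)\in X^2: x\sim y\}$ with the topology induced from $X^2$. For each $x$, $\nu^x$ denotes the counting measure on $[x]$. The relation $\sim$ (the groupoid $G$) is assumed continuous with respect to the symbolic structure: the elements of each class $[y]$ are listed (each exactly once) as an ordered tuple $(\psi_1(y),\dots,\psi_k(y))$, $k=\sharp[y]$,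 where this ordered list depends only on the class $[y]$, and for every $\varepsilon>0$ there is $\delta>0$ such that, whenever $d_X(x,z)<\delta$ and $1\le j\le d$, one has $\sharp[j*x]=\sharp[j*z]=:k$ and $\max_{1\le i\le k} d_X(\psi_i(j*x),\psi_i(j*z))<\varepsilon$. The dual $L^*$ of an operator $L$ on $C^0(X)$ acts on finite Borel measures by $\int f\,d(L^*M)=\int L(f)\,dM$ for $f\in C^0(X)$. In the quasi-invariance condition, "integrable $h$" means a Borel function $h$ for which both double integrals converge absolutely. *)

theory Defs
  imports "HOL-Analysis.Analysis"
begin

text \<open>
  Sequences are indexed from \<open>0\<close>: the mathematical \<open>x\<^sub>n\<close>, \<open>n \<ge> 1\<close>, is \<open>x (n - 1)\<close>. The sequence
  \<open>j * x\<close> is \<open>case_nat j x\<close>.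
\<close>

type_synonym seq = "nat \<Rightarrow> nat"

definition shift_space :: "nat \<Rightarrow> seq set" where
  "shift_space d = {x. \<forall>n. x n \<in> {1..d}}"

text \<open>The \<open>Suc\<close> converts the zero-based index of the first difference to the one-based one.\<close>

definition seq_dist :: "seq \<Rightarrow> seq \<Rightarrow> real" where
  "seq_dist x z = (if x = z then 0 else (1/2) ^ Suc (LEAST n. x n \<noteq> z n))"

lemma seq_dist_less_iff: "seq_dist x z < (1/2) ^ n \<longleftrightarrow> (\<forall>i<n. x i = z i)"
proof (cases "x = z")
  case False
  define L where "L = (LEAST n. x n \<noteq> z n)"
  have ex: "\<exists>n. x n \<noteq> z n"
    using False by auto
  have L: "x L \<noteq> z L" "\<And>i. i < L \<Longrightarrow> x i = z i"
    unfolding L_def using LeastI_ex[OF ex] not_less_Least by blast+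
  have "seq_dist x z < (1/2) ^ n \<longleftrightarrow> n < Suc L"
    using False by (simp only: seq_dist_def L_def[symmetric] if_False)
      (rule power_strict_decreasing_iff; simp)
  also have "\<dots> \<longleftrightarrow> (\<forall>i<n. x i = z i)"
    using L by (metis less_Suc_eq_le linorder_not_less order_less_le_trans)
  finally show ?thesis .
qed (simp add: seq_dist_def)

lemma Metric_space_shift_space: "Metric_space (shift_space d) seq_dist"
proof
  fix x y z :: seq
  show "0 \<le> seq_dist x y"
    by (simp add: seq_dist_def)
  show "seq_dist x y = seq_dist y x"
    unfolding seq_dist_def using eq_commute[of x y] eq_commute[of "x _" "y _"] by presburger
  show "seq_dist x y = 0 \<longleftrightarrow> x = y"
    by (simp add: seq_dist_def)
  show "seq_dist x z \<le> seq_dist x y + seq_dist y z"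
  proof (cases "x = z")
    case False
    define L where "L = (LEAST n. x n \<noteq> z n)"
    have "\<exists>n. x n \<noteq> z n"
      using False by auto
    then have "x L \<noteq> z L"
      unfolding L_def by (rule LeastI_ex)
    then have "\<not> (seq_dist x y < (1/2) ^ Suc L \<and> seq_dist y z < (1/2) ^ Suc L)"
      unfolding seq_dist_less_iff by auto
    moreover have "seq_dist x z = (1/2) ^ Suc L"
      using False by (simp add: seq_dist_def L_def)
    moreover have "0 \<le> seq_dist x y" "0 \<le> seq_dist y z"
      by (simp_all add: seq_dist_def)
    ultimately show ?thesis
      by linarith
  qed (simp add: seq_dist_def)
qed

text \<open>
  The metric topology is the subspace topology inherited from the library's product topology on
  \<^typ>\<open>nat \<Rightarrow> nat\<close>, so \<^const>\<open>continuous_on\<close>, \<^const>\<open>top_of_set\<close> and \<^const>\<open>borel\<close> refer to the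
  topology given by \<^const>\<open>seq_dist\<close>.
\<close>

lemma mtopology_shift_space:
  "Metric_space.mtopology (shift_space d) seq_dist = top_of_set (shift_space d)"
proof -
  interpret Metric_space "shift_space d" seq_dist
    by (rule Metric_space_shift_space)
  show ?thesis
    unfolding topology_eq
  proof (intro allI iffI)
    fix U assume U: "openin mtopology U"
    show "openin (top_of_set (shift_space d)) U"
    proof (subst openin_subopen, intro ballI)
      fix x assume x: "x \<in> U"
      then obtain r where r: "r > 0" "mball x r \<subseteq> U"
        using U by (auto simp: openin_mtopology)
      obtain n where n: "(1/2::real) ^ n < r"
        using real_arch_pow_inv[OF r(1), of "1/2"] by auto
      define W where "W = (\<Inter>i<n. (\<lambda>z::seq. z i) -` {x i})"
      have "open W"
        unfolding W_def by (intro open_INT finite_lessThan ballI open_vimage open_discrete)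
          (rule continuous_on_product_coordinates)
      moreover have "x \<in> shift_space d"
        using x U by (auto simp: openin_mtopology)
      moreover have "shift_space d \<inter> W \<subseteq> U"
      proof
        fix z assume z: "z \<in> shift_space d \<inter> W"
        then have "seq_dist x z < (1/2) ^ n"
          unfolding seq_dist_less_iff by (auto simp: W_def)
        then show "z \<in> U"
          using r n z \<open>x \<in> shift_space d\<close> by (auto simp: subset_iff)
      qed
      ultimately show "\<exists>T. openin (top_of_set (shift_space d)) T \<and> x \<in> T \<and> T \<subseteq> U"
        by (intro exI[of _ "shift_space d \<inter> W"]) (auto simp: W_def openin_open)
    qed
  next
    fix U assume "openin (top_of_set (shift_space d)) U"
    then obtain T where T: "open T" "U = shift_space d \<inter> T"
      by (auto simp: openin_open)
    show "openin mtopology U"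
      unfolding openin_mtopology
    proof (intro conjI allI impI)
      show "U \<subseteq> shift_space d"
        using T by auto
      fix x assume "x \<in> U"
      then have x: "x \<in> shift_space d" "x \<in> T"
        using T by auto
      have "openin (product_topology (\<lambda>i. euclidean) UNIV) T"
        using T(1) by (simp add: euclidean_product_topology)
      from product_topology_open_contains_basis[OF this x(2)] obtain Y where
        Y: "x \<in> (\<Pi>\<^sub>E i\<in>UNIV. Y i)" "finite {i. Y i \<noteq> UNIV}" "(\<Pi>\<^sub>E i\<in>UNIV. Y i) \<subseteq> T"
        by auto
      obtain n where n: "\<And>i. Y i \<noteq> UNIV \<Longrightarrow> i < n"
        using Y(2) unfolding finite_nat_set_iff_bounded by blast
      have "mball x ((1/2) ^ n) \<subseteq> U"
      proof
        fix z assume "z \<in> mball x ((1/2) ^ n)"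
        then have "z \<in> shift_space d" "seq_dist x z < (1/2) ^ n"
          by simp_all
        then have z: "z \<in> shift_space d" "\<forall>i<n. x i = z i"
          unfolding seq_dist_less_iff by simp_all
        have "z i \<in> Y i" for i
        proof (cases "Y i = UNIV")
          case False
          then have "x i = z i"
            using n z(2) by blast
          moreover have "x i \<in> Y i"
            using Y(1) by (simp add: PiE_iff)
          ultimately show ?thesis
            by simp
        qed simp
        then have "z \<in> T"
          using Y(3) by (auto simp: PiE_iff subset_iff)
        then show "z \<in> U"
          using T z by auto
      qed
      then show "\<exists>r>0. mball x r \<subseteq> U"
        by (intro exI[of _ "(1/2) ^ n"]) auto
    qed
  qed
qed

text \<open>
  An equivalence relation is given by its graph \<open>G\<close>, and the class of \<open>x\<close> is \<open>G `` {x}\<close>. A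
  multivalued map is hemicontinuous if it is both upper and lower hemicontinuous.
\<close>

definition hemicontinuous_on ::
  "'a::topological_space set \<Rightarrow> ('a \<Rightarrow> 'b::topological_space set) \<Rightarrow> 'b set \<Rightarrow> bool" where
  "hemicontinuous_on S F T \<longleftrightarrow>
     (\<forall>x\<in>S. F x \<subseteq> T) \<and>
     (\<forall>U. openin (top_of_set T) U \<longrightarrow> openin (top_of_set S) {x \<in> S. F x \<subseteq> U}) \<and>
     (\<forall>U. openin (top_of_set T) U \<longrightarrow> openin (top_of_set S) {x \<in> S. F x \<inter> U \<noteq> {}})"

definition continuous_symbolic :: "nat \<Rightarrow> (seq \<times> seq) set \<Rightarrow> bool" where
  "continuous_symbolic d G \<longleftrightarrow>
     (\<exists>\<psi> :: nat \<Rightarrow> seq \<Rightarrow> seq.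
        (\<forall>y\<in>shift_space d. bij_betw (\<lambda>i. \<psi> i y) {1..card (G `` {y})} (G `` {y})) \<and>
        (\<forall>(x, y)\<in>G. \<forall>i\<in>{1..card (G `` {y})}. \<psi> i x = \<psi> i y) \<and>
        (\<forall>\<epsilon>>0. \<exists>\<delta>>0. \<forall>x\<in>shift_space d. \<forall>z\<in>shift_space d. \<forall>j\<in>{1..d}.
           seq_dist x z < \<delta> \<longrightarrow>
             card (G `` {case_nat j x}) = card (G `` {case_nat j z}) \<and>
             (\<forall>i\<in>{1..card (G `` {case_nat j x})}.
                seq_dist (\<psi> i (case_nat j x)) (\<psi> i (case_nat j z)) < \<epsilon>)))"

definition haar_ruelle ::
  "nat \<Rightarrow> (seq \<times> seq) set \<Rightarrow> (seq \<Rightarrow> real) \<Rightarrow> (seq \<Rightarrow> real) \<Rightarrow> seq \<Rightarrow> real" where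
  "haar_ruelle d G W f x =
     (1 / real d) * (\<Sum>j=1..d. \<Sum>s\<in>G `` {case_nat j x}. f s * exp (W s))"

definition finite_borel_measure_on :: "'a::topological_space set \<Rightarrow> 'a measure \<Rightarrow> bool" where
  "finite_borel_measure_on S M \<longleftrightarrow>
     finite_measure M \<and> sets M = sets (restrict_space borel S)"

text \<open>
  \<open>dual_image S L M N\<close> says \<open>L\<^sup>* M = N\<close> for an operator \<open>L\<close> on the continuous functions on \<open>S\<close>.
  For compact metrizable \<open>S\<close> such an \<open>N\<close> is unique.
\<close>

definition dual_image ::
  "'a::topological_space set \<Rightarrow> (('a \<Rightarrow> real) \<Rightarrow> 'a \<Rightarrow> real) \<Rightarrow> 'a measure \<Rightarrow> 'a measure \<Rightarrow> bool"
where
  "dual_image S L M N \<longleftrightarrow>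
     finite_borel_measure_on S M \<and> finite_borel_measure_on S N \<and>
     (\<forall>f. continuous_on S f \<longrightarrow> (\<integral>x. f x \<partial>N) = (\<integral>x. L f x \<partial>M))"

definition separable_cocycle :: "(seq \<Rightarrow> real) \<Rightarrow> seq \<times> seq \<Rightarrow> real" where
  "separable_cocycle V = (\<lambda>(x, y). V y - V x)"

definition quasi_invariant ::
  "(seq \<times> seq) set \<Rightarrow> (seq \<times> seq \<Rightarrow> real) \<Rightarrow> real \<Rightarrow> seq measure \<Rightarrow> bool" where
  "quasi_invariant G c \<beta> M \<longleftrightarrow>
     (\<forall>h \<in> borel_measurable (restrict_space borel G).
        integrable M (\<lambda>x. \<Sum>s\<in>G `` {x}. \<bar>h (s, x)\<bar>) \<longrightarrow>
        integrable M (\<lambda>x. \<Sum>s\<in>G `` {x}. \<bar>h (x, s)\<bar> * exp (- \<beta> * c (x, s))) \<longrightarrow>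
        (\<integral>x. (\<Sum>s\<in>G `` {x}. h (s, x)) \<partial>M) =
        (\<integral>x. (\<Sum>s\<in>G `` {x}. h (x, s) * exp (- \<beta> * c (x, s))) \<partial>M))"

end

theory Submission
  imports Defs
begin

text \<open>
  The continuity of the listing makes \<open>x \<mapsto> \<sharp>[x]\<close> locally constant and each \<open>\<psi>\<^sub>i\<close> continuous where it is
  defined, so sums over classes of Borel functions are Borel, and
  \<open>f \<mapsto> \<integral> L f dM\<close> is integration against a Borel measure. As cylinders are clopen, the eigenvalue equation
  extends from continuous functions to all nonnegative Borel \<open>f\<close>. Now for \<open>h \<ge> 0\<close> put
  \<open>F x = \<Sum>\<^bsub>s \<in> [x]\<^esub> h (s, x)\<close> and \<open>F' x = \<Sum>\<^bsub>s \<in> [x]\<^esub> h (x, s) e\<^bsup>W s - W x\<^esup>\<close> with \<open>W = - \<beta> V\<close>. Exchanging the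
  two sums over a class gives \<open>L F = L F'\<close> pointwise, whence
  \<open>\<lambda> \<integral> F dM = \<integral> L F dM = \<integral> L F' dM = \<lambda> \<integral> F' dM\<close>.
\<close>

section \<open>Compactness, measurability and cylinders of the shift space\<close>

lemma compact_shift_space: "compact (shift_space d)"
proof -
  have "shift_space d = PiE UNIV (\<lambda>_. {1..d})"
    by (auto simp: shift_space_def PiE_iff)
  moreover have "compactin (product_topology (\<lambda>_. euclidean) UNIV) (PiE UNIV (\<lambda>_::nat. {1..d::nat}))"
    unfolding compactin_PiE by (auto intro: finite_imp_compact)
  ultimately show ?thesis
    by (simp add: euclidean_product_topology)
qed

lemma borel_shift_space: "shift_space d \<in> sets borel"
proof -
  have "shift_space d = (\<Inter>n. (\<lambda>x. x n) -` {1..d})"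
    by (auto simp: shift_space_def)
  also have "closed \<dots>"
    by (intro closed_INT ballI closed_vimage continuous_on_product_coordinates finite_imp_closed) simp
  finally show ?thesis
    by (rule borel_closed)
qed

lemma case_nat_shift_space: "j \<in> {1..d} \<Longrightarrow> x \<in> shift_space d \<Longrightarrow> case_nat j x \<in> shift_space d"
  by (auto simp: shift_space_def split: nat.splits)

text \<open>The sequences that share the first \<open>n\<close> coordinates of \<open>x\<close> form
  an open set, and \<open>f\<close> is constant on its trace on \<open>A\<close>. Hence the target
  may carry any topology.\<close>

lemma continuous_on_if_prefix_determined:
  fixes f :: "seq \<Rightarrow> 'a::topological_space"
  assumes "\<And>x y. x \<in> A \<Longrightarrow> y \<in> A \<Longrightarrow> (\<forall>i<n. x i = y i) \<Longrightarrow> f x = f y"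
  shows "continuous_on A f"
  unfolding continuous_on_topological
proof (intro ballI allI impI)
  fix x B assume x: "x \<in> A" and B: "open B" "f x \<in> B"
  define W where "W = (\<Inter>i<n. (\<lambda>z::seq. z i) -` {x i})"
  have "open W"
    unfolding W_def by (intro open_INT finite_lessThan ballI open_vimage open_discrete)
      (rule continuous_on_product_coordinates)
  moreover have "f y \<in> B" if "y \<in> A" "y \<in> W" for y
    using assms[OF x that(1)] that(2) B(2) by (auto simp: W_def)
  ultimately show "\<exists>U. open U \<and> x \<in> U \<and> (\<forall>y\<in>A. y \<in> U \<longrightarrow> f y \<in> B)"
    by (intro exI[of _ W]) (auto simp: W_def)
qed

lemma continuous_on_case_nat: "continuous_on A (case_nat j :: seq \<Rightarrow> seq)"
proof (rule continuous_on_coordinatewise_then_product)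
  fix i show "continuous_on A (\<lambda>x::seq. case i of 0 \<Rightarrow> j | Suc n \<Rightarrow> x n)"
    by (cases i) (auto intro!: continuous_intros continuous_on_product_coordinates[THEN continuous_on_subset])
qed

text \<open>Membership depends only on coordinates below a bound for \<open>J\<close>. This makes
  indicators of cylinders admissible test functions for \<open>dual_image\<close>.\<close>

lemma continuous_on_indicator_cylinder:
  assumes "finite J"
  shows "continuous_on A (indicator {x :: seq. \<forall>i\<in>J. x i \<in> E i} :: seq \<Rightarrow> real)"
proof -
  obtain n where "\<And>i. i \<in> J \<Longrightarrow> i < n"
    using assms unfolding finite_nat_set_iff_bounded by blast
  then show ?thesis
    by (intro continuous_on_if_prefix_determined[of _ n]) (auto simp: indicator_def)
qed

text \<open>Cylinders form an intersection-stable generator of the product \<sigma>-algebra, which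
  here is the Borel \<sigma>-algebra.\<close>

lemma measure_eqI_cylinder:
  fixes M N :: "seq measure"
  assumes "finite_measure M" "sets M = sets borel" "sets N = sets borel"
    and "\<And>J E. finite J \<Longrightarrow> emeasure M {x. \<forall>i\<in>J. x i \<in> E i} = emeasure N {x. \<forall>i\<in>J. x i \<in> E i}"
  shows "M = N"
proof (rule measure_eqI_PiM_infinite[where I = UNIV and M = "\<lambda>_. borel"])
  fix J :: "nat set" and E :: "nat \<Rightarrow> nat set"
  assume "finite J"
  moreover have "prod_emb UNIV (\<lambda>_. borel) J (Pi\<^sub>E J E) = {x. \<forall>i\<in>J. x i \<in> E i}"
    by (auto simp: prod_emb_def PiE_iff)
  ultimately show "emeasure M (prod_emb UNIV (\<lambda>_. borel) J (Pi\<^sub>E J E)) =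
      emeasure N (prod_emb UNIV (\<lambda>_. borel) J (Pi\<^sub>E J E))"
    using assms(4) by simp
qed (use assms in \<open>simp_all add: sets_PiM_equal_borel\<close>)

section \<open>Continuity of the class listing\<close>

text \<open>Fixes one witness of the existential in \<open>continuous_symbolic\<close>, so that the
  lemmas below share the same maps \<open>\<psi> i\<close>.\<close>

locale class_listing =
  fixes d :: nat and G :: "(seq \<times> seq) set" and \<psi> :: "nat \<Rightarrow> seq \<Rightarrow> seq"
  assumes equiv: "equiv (shift_space d) G"
    and bij_listing: "\<And>y. y \<in> shift_space d \<Longrightarrow> bij_betw (\<lambda>i. \<psi> i y) {1..card (G `` {y})} (G `` {y})"
    and uniform_listing: "\<And>\<epsilon>. \<epsilon> > 0 \<Longrightarrow> \<exists>\<delta>>0. \<forall>x\<in>shift_space d. \<forall>z\<in>shift_space d. \<forall>j\<in>{1..d}.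
           seq_dist x z < \<delta> \<longrightarrow>
             card (G `` {case_nat j x}) = card (G `` {case_nat j z}) \<and>
             (\<forall>i\<in>{1..card (G `` {case_nat j x})}.
                seq_dist (\<psi> i (case_nat j x)) (\<psi> i (case_nat j z)) < \<epsilon>)"
begin

lemma class_subset: "(x, y) \<in> G \<Longrightarrow> x \<in> shift_space d \<and> y \<in> shift_space d"
  using equiv by (auto simp: equiv_def refl_on_def)

text \<open>Every point of the shift space has the form \<open>j * x\<close>, so the hypothesis on
  points \<open>j * x\<close> controls all classes. As \<open>seq_dist\<close> is below
  \<open>(1/2) ^ n\<close> exactly when the first \<open>n\<close> coordinates agree, the
  \<epsilon>-\<delta> condition becomes a statement about prefixes.\<close>

lemma prefix_determined_listing:
  "\<exists>m. \<forall>x\<in>shift_space d. \<forall>z\<in>shift_space d. (\<forall>i<m. x i = z i) \<longrightarrow>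
     card (G `` {x}) = card (G `` {z}) \<and>
     (\<forall>i\<in>{1..card (G `` {x})}. \<forall>k<n. \<psi> i x k = \<psi> i z k)"
proof -
  obtain \<delta> where \<delta>: "\<delta> > 0" and unif: "\<And>x z j. x \<in> shift_space d \<Longrightarrow> z \<in> shift_space d \<Longrightarrow> j \<in> {1..d} \<Longrightarrow>
      seq_dist x z < \<delta> \<Longrightarrow> card (G `` {case_nat j x}) = card (G `` {case_nat j z}) \<and>
             (\<forall>i\<in>{1..card (G `` {case_nat j x})}.
                seq_dist (\<psi> i (case_nat j x)) (\<psi> i (case_nat j z)) < (1/2) ^ n)"
    using uniform_listing[of "(1/2) ^ n"] by (metis half_gt_zero_iff zero_less_one zero_less_power)
  obtain m where m: "(1/2::real) ^ m < \<delta>"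
    using real_arch_pow_inv[OF \<delta>, of "1/2"] by auto
  show ?thesis
  \<comment> \<open>One coordinate secures the common first symbol, the other \<open>m\<close> bring
    the tails within \<delta>.\<close>
  proof (intro exI[of _ "Suc m"] ballI impI)
    fix x z assume x: "x \<in> shift_space d" and z: "z \<in> shift_space d" and eq: "\<forall>i<Suc m. x i = z i"
    have tails: "(\<lambda>n. x (Suc n)) \<in> shift_space d" "(\<lambda>n. z (Suc n)) \<in> shift_space d" "x 0 \<in> {1..d}"
      using x z by (auto simp: shift_space_def)
    have cons: "case_nat (x 0) (\<lambda>n. x (Suc n)) = x" "case_nat (x 0) (\<lambda>n. z (Suc n)) = z"
      using eq by (auto simp: fun_eq_iff split: nat.split)
    have "seq_dist (\<lambda>n. x (Suc n)) (\<lambda>n. z (Suc n)) < (1/2) ^ m"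
      unfolding seq_dist_less_iff using eq by auto
    with unif[OF tails] m
    show "card (G `` {x}) = card (G `` {z}) \<and>
     (\<forall>i\<in>{1..card (G `` {x})}. \<forall>k<n. \<psi> i x k = \<psi> i z k)"
      by (simp add: cons seq_dist_less_iff)
  qed
qed

lemma continuous_on_card_class:
  fixes g :: "nat \<Rightarrow> 'a::topological_space"
  shows "continuous_on (shift_space d) (\<lambda>x. g (card (G `` {x})))"
proof -
  \<comment> \<open>Prefix length \<open>0\<close> is enough, since only the class size matters
    here.\<close>
  obtain m where "\<forall>x\<in>shift_space d. \<forall>z\<in>shift_space d. (\<forall>i<m. x i = z i) \<longrightarrow>
     card (G `` {x}) = card (G `` {z})"
    using prefix_determined_listing[of 0] by blast
  then show ?thesis
    by (intro continuous_on_if_prefix_determined[of _ m]) metis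
qed

text \<open>Each coordinate of \<open>\<psi> i x\<close> is determined by a prefix of
  \<open>x\<close> as long as \<open>i\<close> is a valid index; beyond the class size the listing
  does not constrain \<open>\<psi> i\<close>.\<close>

lemma continuous_on_listing:
  "continuous_on {x \<in> shift_space d. i \<in> {1..card (G `` {x})}} (\<psi> i)"
proof (rule continuous_on_coordinatewise_then_product)
  fix k
  obtain m where "\<forall>x\<in>shift_space d. \<forall>z\<in>shift_space d. (\<forall>i<m. x i = z i) \<longrightarrow>
     (\<forall>i\<in>{1..card (G `` {x})}. \<forall>l<Suc k. \<psi> i x l = \<psi> i z l)"
    using prefix_determined_listing[of "Suc k"] by blast
  then show "continuous_on {x \<in> shift_space d. i \<in> {1..card (G `` {x})}} (\<lambda>x. \<psi> i x k)"
    by (intro continuous_on_if_prefix_determined[of _ m]) simp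
qed

text \<open>A continuous function on a compact space is bounded. The bound gives sums over classes
  of varying size a common index range.\<close>

lemma card_class_bounded: "\<exists>K. \<forall>x\<in>shift_space d. card (G `` {x}) \<le> K"
proof -
  have "bounded ((\<lambda>x. real (card (G `` {x}))) ` shift_space d)"
    by (intro compact_imp_bounded compact_continuous_image compact_shift_space continuous_on_card_class)
  then obtain B where "\<And>x. x \<in> shift_space d \<Longrightarrow> real (card (G `` {x})) \<le> B"
    by (auto simp: bounded_iff)
  then show ?thesis
    by (metis of_nat_le_iff order_trans real_nat_ceiling_ge)
qed

section \<open>Measurability of sums over classes\<close>

text \<open>The set where \<open>i\<close> is a valid index is Borel, and on it
  \<open>x \<mapsto> (x, \<psi> i x)\<close> is continuous into \<open>G\<close>; off it the
  function is the constant \<open>c\<close>. The target \<open>N\<close> is general because real,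
  \<open>ennreal\<close> and sequence values all occur below.\<close>

lemma measurable_listing:
  assumes u: "u \<in> measurable (restrict_space borel G) N" and c: "c \<in> space N"
  shows "(\<lambda>x. if i \<in> {1..card (G `` {x})} then u (x, \<psi> i x) else c)
    \<in> measurable (restrict_space borel (shift_space d)) N"
proof (subst measurable_If_restrict_space_iff)
  let ?S = "restrict_space borel (shift_space d)"
  let ?A = "{x \<in> shift_space d. i \<in> {1..card (G `` {x})}}"
  have "(\<lambda>x. (x, \<psi> i x)) \<in> measurable (restrict_space borel ?A) (restrict_space borel G)"
  proof (rule measurable_restrict_space2)
    show "(\<lambda>x. (x, \<psi> i x)) \<in> borel_measurable (restrict_space borel ?A)"
      by (intro borel_measurable_continuous_on_restrict continuous_on_Pair continuous_on_id
          continuous_on_listing)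
    show "(\<lambda>x. (x, \<psi> i x)) \<in> space (restrict_space borel ?A) \<rightarrow> G"
      using bij_betw_apply[OF bij_listing] by (simp add: space_restrict_space)
  qed
  then have "(\<lambda>x. u (x, \<psi> i x)) \<in> measurable (restrict_space borel ?A) N"
    using u by (rule measurable_compose)
  moreover have "measurable (restrict_space ?S {x. i \<in> {1..card (G `` {x})}}) N =
      measurable (restrict_space borel ?A) N"
    unfolding Collect_conj_eq Collect_mem_eq
    by (rule measurable_cong_sets[OF sets_restrict_restrict_space refl])
  ultimately show "(\<lambda>x. u (x, \<psi> i x)) \<in> measurable (restrict_space ?S {x. i \<in> {1..card (G `` {x})}}) N \<and>
    (\<lambda>x. c) \<in> measurable (restrict_space ?S {x. i \<notin> {1..card (G `` {x})}}) N"
    by (metis measurable_const[OF c])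
next
  let ?S = "restrict_space borel (shift_space d)"
  have card: "(\<lambda>x. real (card (G `` {x}))) \<in> borel_measurable ?S"
    by (intro borel_measurable_continuous_on_restrict continuous_on_card_class)
  \<comment> \<open>The index \<open>0\<close> is never valid, hence the empty set in that
    case.\<close>
  have "{x \<in> space ?S. i \<in> {1..card (G `` {x})}} =
      (\<lambda>x. real (card (G `` {x}))) -` (if 1 \<le> i then {real i..} else {}) \<inter> space ?S"
    by auto
  also have "\<dots> \<in> sets ?S"
    by (rule measurable_sets[OF card]) simp
  finally show "{x \<in> space ?S. i \<in> {1..card (G `` {x})}} \<in> sets ?S" .
qed

text \<open>The listing is a bijection onto the class; padding with zeros makes the index range
  independent of \<open>x\<close>, which allows termwise measurability arguments.\<close>

lemma class_sum_eq:
  assumes "x \<in> shift_space d" "card (G `` {x}) \<le> K"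
  shows "(\<Sum>s\<in>G `` {x}. g s) = (\<Sum>i=1..K. if i \<in> {1..card (G `` {x})} then g (\<psi> i x) else 0)"
proof -
  have "(\<Sum>s\<in>G `` {x}. g s) = (\<Sum>i=1..card (G `` {x}). g (\<psi> i x))"
    by (rule sum.reindex_bij_betw[OF bij_listing[OF assms(1)], symmetric])
  also have "\<dots> = (\<Sum>i=1..K. if i \<in> {1..card (G `` {x})} then g (\<psi> i x) else 0)"
    using assms(2) by (intro sum.mono_neutral_cong_left) auto
  finally show ?thesis .
qed

lemma borel_measurable_class_sum:
  fixes u :: "seq \<times> seq \<Rightarrow> 'b::{second_countable_topology, topological_comm_monoid_add}"
  assumes u: "u \<in> borel_measurable (restrict_space borel G)"
  shows "(\<lambda>x. \<Sum>s\<in>G `` {x}. u (x, s)) \<in> borel_measurable (restrict_space borel (shift_space d))"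
proof -
  let ?S = "restrict_space borel (shift_space d)"
  obtain K where K: "\<And>x. x \<in> shift_space d \<Longrightarrow> card (G `` {x}) \<le> K"
    using card_class_bounded by blast
  have "(\<lambda>x. \<Sum>i=1..K. if i \<in> {1..card (G `` {x})} then u (x, \<psi> i x) else 0) \<in> borel_measurable ?S"
    by (intro borel_measurable_sum measurable_listing u) simp
  moreover have "(\<Sum>s\<in>G `` {x}. u (x, s)) =
      (\<Sum>i=1..K. if i \<in> {1..card (G `` {x})} then u (x, \<psi> i x) else 0)" if "x \<in> space ?S" for x
    using that by (intro class_sum_eq K) (simp_all add: space_restrict_space)
  ultimately show ?thesis
    by (simp cong: measurable_cong)
qed

lemma measurable_snd_class:
  assumes "f \<in> measurable (restrict_space borel (shift_space d)) N"
  shows "(\<lambda>p. f (snd p)) \<in> measurable (restrict_space borel G) N"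
  by (rule measurable_compose[OF measurable_restrict_space3 assms])
    (use class_subset borel_measurable_continuous_onI[OF continuous_on_snd[OF continuous_on_id]] in auto)

lemma measurable_fst_class:
  assumes "f \<in> measurable (restrict_space borel (shift_space d)) N"
  shows "(\<lambda>p. f (fst p)) \<in> measurable (restrict_space borel G) N"
  by (rule measurable_compose[OF measurable_restrict_space3 assms])
    (use class_subset borel_measurable_continuous_onI[OF continuous_on_fst[OF continuous_on_id]] in auto)

text \<open>Holds by symmetry of \<open>G\<close>. It brings sums of \<open>h (s, x)\<close> into
  the form \<open>u (x, s)\<close> of \<open>borel_measurable_class_sum\<close>.\<close>

lemma measurable_swap_class:
  assumes "u \<in> measurable (restrict_space borel G) N"
  shows "(\<lambda>p. u (snd p, fst p)) \<in> measurable (restrict_space borel G) N"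
proof (rule measurable_compose[OF measurable_restrict_space3 assms])
  show "(\<lambda>p::seq \<times> seq. (snd p, fst p)) \<in> borel_measurable borel"
    by (intro borel_measurable_continuous_onI continuous_on_Pair continuous_on_fst continuous_on_snd
        continuous_on_id)
  show "(\<lambda>p. (snd p, fst p)) \<in> G \<rightarrow> G"
    using equiv by (auto elim!: equivE dest: symD)
qed

lemma measurable_case_nat:
  "f \<in> measurable (restrict_space borel (shift_space d)) N \<Longrightarrow> j \<in> {1..d} \<Longrightarrow>
   (\<lambda>x. f (case_nat j x)) \<in> measurable (restrict_space borel (shift_space d)) N"
  by (rule measurable_compose[OF measurable_restrict_space3[of "case_nat j" borel borel]])
    (auto intro!: borel_measurable_continuous_onI continuous_on_case_nat case_nat_shift_space)

section \<open>Measurability and boundedness of the Haar-Ruelle operator\<close>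

lemma borel_measurable_haar_ruelle:
  assumes "f \<in> borel_measurable (restrict_space borel (shift_space d))"
    and W: "W \<in> borel_measurable (restrict_space borel (shift_space d))"
  shows "haar_ruelle d G W f \<in> borel_measurable (restrict_space borel (shift_space d))"
proof -
  have "(\<lambda>p. f (snd p) * exp (W (snd p))) \<in> borel_measurable (restrict_space borel G)"
    by (intro borel_measurable_times assms measurable_snd_class measurable_compose[OF _ borel_measurable_exp])
  from borel_measurable_class_sum[OF this] show ?thesis
    unfolding haar_ruelle_def[abs_def] snd_conv
    by (intro borel_measurable_times borel_measurable_const borel_measurable_sum measurable_case_nat)
qed

text \<open>Class sizes are bounded, and \<open>W\<close> is bounded on the compact shift space. For
  indicators this yields integrability against a finite measure.\<close>

lemma haar_ruelle_bounded:
  assumes "continuous_on (shift_space d) W" "\<And>x. \<bar>f x\<bar> \<le> 1"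
  shows "\<exists>B. \<forall>x\<in>shift_space d. \<bar>haar_ruelle d G W f x\<bar> \<le> B"
proof -
  obtain K where K: "\<And>x. x \<in> shift_space d \<Longrightarrow> card (G `` {x}) \<le> K"
    using card_class_bounded by blast
  have "bounded (W ` shift_space d)"
    by (intro compact_imp_bounded compact_continuous_image compact_shift_space assms)
  then obtain C where C: "\<And>x. x \<in> shift_space d \<Longrightarrow> W x \<le> C"
    by (auto simp: bounded_iff abs_le_iff)
  have class_bound: "\<bar>\<Sum>s\<in>G `` {y}. f s * exp (W s)\<bar> \<le> real K * exp C" if y: "y \<in> shift_space d" for y
  proof -
    have "\<bar>f s * exp (W s)\<bar> \<le> exp C" if "s \<in> G `` {y}" for s
      using mult_mono[OF assms(2)[of s], of "exp (W s)" "exp C"] C[of s] class_subset[of y s] that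
      by (simp add: abs_mult)
    then have "\<bar>\<Sum>s\<in>G `` {y}. f s * exp (W s)\<bar> \<le> real (card (G `` {y})) * exp C"
      by (intro order_trans[OF sum_abs] sum_bounded_above)
    also have "\<dots> \<le> real K * exp C"
      using K[OF y] by simp
    finally show ?thesis .
  qed
  have "\<bar>haar_ruelle d G W f x\<bar> \<le> (1 / real d) * (\<Sum>j=1..d. real K * exp C)"
    if "x \<in> shift_space d" for x
    unfolding haar_ruelle_def abs_mult
    by (intro mult_mono order_trans[OF sum_abs sum_mono] class_bound case_nat_shift_space that) auto
  then show ?thesis
    by blast
qed

text \<open>Moving the factor \<open>1 / d\<close> into the weight gives an expression that also
  makes sense for \<open>ennreal\<close>-valued functions; the dual identity is extended in this
  form.\<close>

lemma ennreal_haar_ruelle: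
  assumes "\<And>x. 0 \<le> f x"
  shows "ennreal (haar_ruelle d G W f x) =
    (\<Sum>j=1..d. \<Sum>s\<in>G `` {case_nat j x}. ennreal (f s) * ennreal (exp (W s) / real d))"
proof -
  have "haar_ruelle d G W f x = (\<Sum>j=1..d. \<Sum>s\<in>G `` {case_nat j x}. f s * (exp (W s) / real d))"
    by (simp add: haar_ruelle_def sum_distrib_left)
  then show ?thesis
    using assms by (simp add: sum_nonneg flip: ennreal_mult)
qed

section \<open>The dual operator as a push-forward\<close>

text \<open>The triples \<open>(x, j, i)\<close> with valid \<open>i\<close> enumerate the terms of
  the operator at \<open>x\<close>. A function of triples lets the double sum be read as an integral
  over a product with counting measure; \<open>c\<close> is the value at invalid indices.\<close>

definition at_preimage :: "(seq \<Rightarrow> 'c) \<Rightarrow> 'c \<Rightarrow> seq \<times> nat \<times> nat \<Rightarrow> 'c" where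
  "at_preimage g c = (\<lambda>(x, j, i).
     if i \<in> {1..card (G `` {case_nat j x})} then g (\<psi> i (case_nat j x)) else c)"

text \<open>There are finitely many pairs \<open>(j, i)\<close>, so measurability in
  \<open>x\<close> for each fixed pair suffices.\<close>

lemma measurable_at_preimage:
  assumes M: "sets M = sets (restrict_space borel (shift_space d))"
    and g: "g \<in> measurable (restrict_space borel (shift_space d)) L" and c: "c \<in> space L"
  shows "at_preimage g c \<in> measurable (M \<Otimes>\<^sub>M count_space ({1..d} \<times> {1..K})) L"
proof -
  have "(\<lambda>x. at_preimage g c (x, ji)) \<in> measurable M L" if ji_in: "ji \<in> {1..d} \<times> {1..K}" for ji
  proof -
    obtain j i where ji: "ji = (j, i)" "j \<in> {1..d}"
      using ji_in by (blast elim: SigmaE)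
    show ?thesis
      unfolding at_preimage_def ji prod.case measurable_cong_sets[OF M refl]
      using measurable_case_nat[OF measurable_listing[OF measurable_snd_class[OF g] c, of i] ji(2)]
      by (simp only: snd_conv)
  qed
  then have "(\<lambda>p. at_preimage g c (fst p, snd p)) \<in> measurable (M \<Otimes>\<^sub>M count_space ({1..d} \<times> {1..K})) L"
    by (rule measurable_compose_countable'[where f = "\<lambda>ji p. at_preimage g c (fst p, ji)" and g = snd,
          OF measurable_compose[OF measurable_fst] measurable_snd])
      (simp_all add: countable_finite)
  then show ?thesis
    unfolding prod.collapse .
qed

text \<open>Take the product of \<open>M\<close> with counting measure on the pairs
  \<open>(j, i)\<close>, weight it by \<open>exp W / d\<close> at the selected point, and push it
  forward to that point. Tonelli's theorem then produces the double sum.\<close>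

lemma nn_integral_pushforward:
  fixes W :: "seq \<Rightarrow> real"
  assumes M: "sets M = sets (restrict_space borel (shift_space d))"
    and W: "W \<in> borel_measurable (restrict_space borel (shift_space d))"
  shows "\<exists>N. sets N = sets borel \<and> (\<forall>f\<in>borel_measurable borel. (\<integral>\<^sup>+x. f x \<partial>N) =
    (\<integral>\<^sup>+x. (\<Sum>j=1..d. \<Sum>s\<in>G `` {case_nat j x}. f s * ennreal (exp (W s) / real d)) \<partial>M))"
proof -
  obtain K where K: "\<And>x. x \<in> shift_space d \<Longrightarrow> card (G `` {x}) \<le> K"
    using card_class_bounded by blast
  \<comment> \<open>The default weight \<open>0\<close> removes the triples with an invalid index,
    so the default point in \<open>?s\<close> can be arbitrary.\<close>
  let ?w = "at_preimage (\<lambda>s. ennreal (exp (W s) / real d)) 0"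
  let ?s = "at_preimage id undefined"
  define C where "C = count_space ({1..d} \<times> {1..K})"
  interpret C: sigma_finite_measure C
    unfolding C_def by (intro sigma_finite_measure_count_space_finite) simp
  have space_M: "space M = shift_space d"
    using sets_eq_imp_space_eq[OF M] by (simp add: space_restrict_space)
  define N where "N = distr (density (M \<Otimes>\<^sub>M C) ?w) borel ?s"
  have weight: "?w \<in> borel_measurable (M \<Otimes>\<^sub>M C)"
    unfolding C_def
    by (intro measurable_at_preimage M measurable_compose[OF _ measurable_ennreal]
        borel_measurable_divide measurable_compose[OF W borel_measurable_exp] borel_measurable_const) simp
  have point: "?s \<in> borel_measurable (M \<Otimes>\<^sub>M C)"
    unfolding C_def
    by (intro measurable_at_preimage M borel_measurable_continuous_on_restrict
        continuous_on_id[folded id_def]) simp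
  have "(\<integral>\<^sup>+x. f x \<partial>N) =
      (\<integral>\<^sup>+x. (\<Sum>j=1..d. \<Sum>s\<in>G `` {case_nat j x}. f s * ennreal (exp (W s) / real d)) \<partial>M)"
    if f: "f \<in> borel_measurable borel" for f :: "seq \<Rightarrow> ennreal"
  proof -
    have fp: "(\<lambda>p. f (?s p)) \<in> borel_measurable (M \<Otimes>\<^sub>M C)"
      by (rule measurable_compose[OF point f])
    have "(\<integral>\<^sup>+x. f x \<partial>N) =
        (\<integral>\<^sup>+p. ?w p * f (?s p) \<partial>(M \<Otimes>\<^sub>M C))"
      unfolding N_def using point f
      by (subst nn_integral_distr) (simp_all only: nn_integral_density[OF weight fp] measurable_density_eq1
          measurable_distr_eq1)
    also have "\<dots> = (\<integral>\<^sup>+x. \<integral>\<^sup>+ji. ?w (x, ji) * f (?s (x, ji)) \<partial>C \<partial>M)"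
      by (rule C.nn_integral_fst[symmetric]) (intro borel_measurable_times_ennreal weight fp)
    also have "\<dots> = (\<integral>\<^sup>+x. (\<Sum>j=1..d. \<Sum>s\<in>G `` {case_nat j x}. f s * ennreal (exp (W s) / real d)) \<partial>M)"
    proof (rule nn_integral_cong)
      fix x assume "x \<in> space M"
      then have x: "case_nat j x \<in> shift_space d" if "j \<in> {1..d}" for j
        using that by (simp only: space_M case_nat_shift_space)
      have "(\<integral>\<^sup>+ji. ?w (x, ji) * f (?s (x, ji)) \<partial>C) =
        (\<Sum>j=1..d. \<Sum>i=1..K. ?w (x, j, i) * f (?s (x, j, i)))"
        unfolding C_def by (simp add: nn_integral_count_space_finite sum.cartesian_product case_prod_unfold)
      also have "\<dots> = (\<Sum>j=1..d. \<Sum>s\<in>G `` {case_nat j x}. f s * ennreal (exp (W s) / real d))"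
      proof (intro sum.cong refl)
        fix j assume "j \<in> {1..d}"
        note j = x[OF this]
        show "(\<Sum>i=1..K. ?w (x, j, i) * f (?s (x, j, i))) =
            (\<Sum>s\<in>G `` {case_nat j x}. f s * ennreal (exp (W s) / real d))"
          unfolding class_sum_eq[OF j K[OF j]]
          by (intro sum.cong refl) (simp add: at_preimage_def mult.commute)
      qed
      finally show "(\<integral>\<^sup>+ji. ?w (x, ji) * f (?s (x, ji)) \<partial>C) =
        (\<Sum>j=1..d. \<Sum>s\<in>G `` {case_nat j x}. f s * ennreal (exp (W s) / real d))" .
    qed
    finally show ?thesis .
  qed
  moreover have "sets N = sets borel"
    by (simp add: N_def)
  ultimately show ?thesis
    by blast
qed

section \<open>Extension of the dual identity to nonnegative Borel functions\<close>

text \<open>Both sides are integrals against Borel measures. These agree on cylinders, whose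
  indicators are continuous, and therefore coincide.\<close>

lemma nn_integral_dual_haar_ruelle:
  fixes f :: "seq \<Rightarrow> ennreal"
  assumes W: "continuous_on (shift_space d) W"
    and dual: "dual_image (shift_space d) (haar_ruelle d G W) M N"
    and f: "f \<in> borel_measurable (restrict_space borel (shift_space d))"
  shows "(\<integral>\<^sup>+x. f x \<partial>N) =
    (\<integral>\<^sup>+x. (\<Sum>j=1..d. \<Sum>s\<in>G `` {case_nat j x}. f s * ennreal (exp (W s) / real d)) \<partial>M)"
proof -
  let ?S = "restrict_space borel (shift_space d)"
  have sets_M: "sets M = sets ?S" and sets_N: "sets N = sets ?S"
    and "finite_measure M" "finite_measure N"
    and dual_integral: "\<And>f. continuous_on (shift_space d) f \<Longrightarrow>
      (\<integral>x. f x \<partial>N) = (\<integral>x. haar_ruelle d G W f x \<partial>M)"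
    using dual by (auto simp: dual_image_def finite_borel_measure_on_def)
  interpret M: finite_measure M by fact
  interpret N: finite_measure N by fact
  have space_M: "space M = shift_space d" and space_N: "space N = shift_space d"
    using sets_eq_imp_space_eq[OF sets_M] sets_eq_imp_space_eq[OF sets_N]
    by (simp_all add: space_restrict_space)
  have W': "W \<in> borel_measurable ?S"
    using W by (rule borel_measurable_continuous_on_restrict)
  have id: "id \<in> borel_measurable N"
    unfolding measurable_cong_sets[OF sets_N refl]
    by (intro borel_measurable_continuous_on_restrict continuous_on_id[folded id_def])
  obtain P where sets_P: "sets P = sets borel" and P: "\<And>f. f \<in> borel_measurable borel \<Longrightarrow>
      (\<integral>\<^sup>+x. f x \<partial>P) =
      (\<integral>\<^sup>+x. (\<Sum>j=1..d. \<Sum>s\<in>G `` {case_nat j x}. f s * ennreal (exp (W s) / real d)) \<partial>M)"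
    using nn_integral_pushforward[OF sets_M W'] by blast
  \<comment> \<open>The push-forward under \<open>id\<close> extends \<open>N\<close> by zero to all
    sequences, so that both measures live on \<open>borel\<close>.\<close>
  have "distr N borel id = P"
  proof (rule measure_eqI_cylinder)
    fix J :: "nat set" and E :: "nat \<Rightarrow> nat set" assume J: "finite J"
    define A where "A = {x :: seq. \<forall>i\<in>J. x i \<in> E i}"
    define a :: "seq \<Rightarrow> real" where "a = indicator A"
    \<comment> \<open>\<open>B = UNIV\<close> shows that \<open>A\<close> is Borel;
      \<open>B = shift_space d\<close> makes \<open>a\<close> a test function for
      \<open>dual_integral\<close>.\<close>
    have a_cont: "continuous_on B a" for B
      unfolding a_def A_def by (rule continuous_on_indicator_cylinder[OF J])
    have A: "A \<in> sets borel"
      using borel_measurable_continuous_onI[OF a_cont] unfolding a_def borel_measurable_indicator_iff by simp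
    have a_meas: "a \<in> borel_measurable ?S"
      using a_cont by (rule borel_measurable_continuous_on_restrict)
    obtain B where B: "\<And>x. x \<in> shift_space d \<Longrightarrow> \<bar>haar_ruelle d G W a x\<bar> \<le> B"
      using haar_ruelle_bounded[OF W, of a] by (auto simp: a_def indicator_def)
    \<comment> \<open>Needed because the Bochner integral in \<^const>\<open>dual_image\<close> is \<open>0\<close> off the integrable functions.\<close>
    have haar_int: "integrable M (haar_ruelle d G W a)"
      by (rule M.integrable_const_bound[of _ B])
        (use B borel_measurable_haar_ruelle[OF a_meas W'] in
          \<open>auto simp: space_M measurable_cong_sets[OF sets_M refl]\<close>)
    have haar_nonneg: "0 \<le> haar_ruelle d G W a x" for x
      unfolding haar_ruelle_def a_def by (intro mult_nonneg_nonneg sum_nonneg) auto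
    have a_int: "integrable N a"
      by (rule N.integrable_const_bound[of _ 1])
        (use a_meas in \<open>auto simp: a_def measurable_cong_sets[OF sets_N refl]\<close>)
    have "emeasure (distr N borel id) A = (\<integral>\<^sup>+x. indicator A x \<partial>distr N borel id)"
      using A by simp
    also have "\<dots> = (\<integral>\<^sup>+x. ennreal (a x) \<partial>N)"
      using id A by (subst nn_integral_distr) (auto simp: a_def ennreal_indicator)
    also have "\<dots> = ennreal (\<integral>x. a x \<partial>N)"
      using a_int by (rule nn_integral_eq_integral) (simp add: a_def)
    also have "\<dots> = ennreal (\<integral>x. haar_ruelle d G W a x \<partial>M)"
      using dual_integral[OF a_cont] by simp
    also have "\<dots> = (\<integral>\<^sup>+x. ennreal (haar_ruelle d G W a x) \<partial>M)"
      using haar_int haar_nonneg by (intro nn_integral_eq_integral[symmetric]) auto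
    also have "\<dots> = (\<integral>\<^sup>+x. (\<Sum>j=1..d. \<Sum>s\<in>G `` {case_nat j x}.
        indicator A s * ennreal (exp (W s) / real d)) \<partial>M)"
      by (subst ennreal_haar_ruelle) (auto simp: a_def ennreal_indicator)
    also have "\<dots> = (\<integral>\<^sup>+x. indicator A x \<partial>P)"
      using A by (intro P[symmetric]) simp
    also have "\<dots> = emeasure P A"
      using A sets_P by simp
    finally show "emeasure (distr N borel id) {x. \<forall>i\<in>J. x i \<in> E i} = emeasure P {x. \<forall>i\<in>J. x i \<in> E i}"
      unfolding A_def .
  qed (use sets_P N.finite_measure_distr[OF id] in simp_all)
  note distr_eq = this
  \<comment> \<open>\<open>f\<close> is measurable only on the shift space, whereas \<open>P\<close>
    integrates functions on all sequences; extension by zero bridges this.\<close>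
  define F where "F x = f x * indicator (shift_space d) x" for x
  have F: "F \<in> borel_measurable borel"
    using f unfolding F_def[abs_def]
    by (subst (asm) borel_measurable_restrict_space_iff_ennreal) (simp_all add: borel_shift_space)
  have F_eq: "F x = f x" if "x \<in> shift_space d" for x
    using that by (simp add: F_def)
  have "(\<integral>\<^sup>+x. f x \<partial>N) = (\<integral>\<^sup>+x. F x \<partial>N)"
    by (intro nn_integral_cong) (simp add: F_eq space_N)
  also have "\<dots> = (\<integral>\<^sup>+x. F x \<partial>P)"
    unfolding distr_eq[symmetric] using id F by (subst nn_integral_distr) auto
  also have "\<dots> = (\<integral>\<^sup>+x. (\<Sum>j=1..d. \<Sum>s\<in>G `` {case_nat j x}. F s * ennreal (exp (W s) / real d)) \<partial>M)"
    by (rule P[OF F])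
  also have "\<dots> = (\<integral>\<^sup>+x. (\<Sum>j=1..d. \<Sum>s\<in>G `` {case_nat j x}. f s * ennreal (exp (W s) / real d)) \<partial>M)"
    using class_subset by (intro nn_integral_cong sum.cong refl) (auto simp: F_eq)
  finally show ?thesis .
qed

section \<open>Quasi-invariance for nonnegative and for integrable functions\<close>

lemma class_eq: "y \<in> G `` {x} \<Longrightarrow> G `` {y} = G `` {x}"
  using equiv by (metis Image_singleton_iff equiv_class_eq)

text \<open>The two integrands have the same image under the operator, and integrating that image
  against \<open>M\<close> recovers \<open>lam\<close> times each integral. Values in
  \<open>ennreal\<close> keep every integral meaningful.\<close>

lemma nn_integral_quasi_invariant:
  fixes h :: "seq \<times> seq \<Rightarrow> ennreal"
  assumes W: "continuous_on (shift_space d) W"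
    and lam: "lam > 0"
    and dual: "dual_image (shift_space d) (haar_ruelle d G W) M (scale_measure (ennreal lam) M)"
    and h: "h \<in> borel_measurable (restrict_space borel G)"
  shows "(\<integral>\<^sup>+x. (\<Sum>s\<in>G `` {x}. h (s, x)) \<partial>M) =
    (\<integral>\<^sup>+x. (\<Sum>s\<in>G `` {x}. h (x, s) * ennreal (exp (W s - W x))) \<partial>M)"
proof -
  let ?S = "restrict_space borel (shift_space d)"
  define F where "F x = (\<Sum>s\<in>G `` {x}. h (s, x))" for x
  define F' where "F' x = (\<Sum>s\<in>G `` {x}. h (x, s) * ennreal (exp (W s - W x)))" for x
  have W': "W \<in> borel_measurable ?S"
    using W by (rule borel_measurable_continuous_on_restrict)
  have sets_M: "sets M = sets ?S"
    using dual by (simp add: dual_image_def finite_borel_measure_on_def)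
  have F: "F \<in> borel_measurable ?S"
    using borel_measurable_class_sum[OF measurable_swap_class[OF h]] by (simp add: F_def[abs_def])
  have "(\<lambda>p. h p * ennreal (exp (W (snd p) - W (fst p)))) \<in> borel_measurable (restrict_space borel G)"
    by (intro borel_measurable_times_ennreal h measurable_compose[OF _ measurable_ennreal]
        measurable_compose[OF _ borel_measurable_exp] borel_measurable_diff
        measurable_fst_class[OF W'] measurable_snd_class[OF W'])
  from borel_measurable_class_sum[OF this] have F': "F' \<in> borel_measurable ?S"
    by (simp add: F'_def[abs_def])
  \<comment> \<open>For \<open>t\<close> in the class of \<open>y\<close> the inner sum again runs
    over that class, so both sides are sums over its square. The cocycle factor turns the weight at
    \<open>t\<close> into the weight at \<open>s\<close>, and exchanging the sums matches the
    two.\<close>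
  have transfer: "(\<Sum>t\<in>G `` {y}. F t * ennreal (exp (W t) / real d)) =
      (\<Sum>t\<in>G `` {y}. F' t * ennreal (exp (W t) / real d))" for y
  proof -
    have exp_eq: "ennreal (exp (W s - W t)) * ennreal (exp (W t) / real d) = ennreal (exp (W s) / real d)" for s t
      by (simp add: exp_diff flip: ennreal_mult)
    have "(\<Sum>t\<in>G `` {y}. F t * ennreal (exp (W t) / real d)) =
        (\<Sum>t\<in>G `` {y}. \<Sum>s\<in>G `` {y}. h (s, t) * ennreal (exp (W t) / real d))"
      by (intro sum.cong refl) (simp only: F_def class_eq sum_distrib_right)
    also have "\<dots> = (\<Sum>t\<in>G `` {y}. \<Sum>s\<in>G `` {y}. h (t, s) * ennreal (exp (W s) / real d))"
      by (rule sum.swap)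
    also have "\<dots> = (\<Sum>t\<in>G `` {y}. F' t * ennreal (exp (W t) / real d))"
      by (intro sum.cong refl) (simp only: F'_def class_eq sum_distrib_right mult.assoc exp_eq)
    finally show ?thesis .
  qed
  have "ennreal lam * (\<integral>\<^sup>+x. F x \<partial>M) = (\<integral>\<^sup>+x. F x \<partial>scale_measure (ennreal lam) M)"
    using F by (simp add: nn_integral_scale_measure measurable_cong_sets[OF sets_M refl])
  also have "\<dots> = (\<integral>\<^sup>+x. F' x \<partial>scale_measure (ennreal lam) M)"
    unfolding nn_integral_dual_haar_ruelle[OF W dual F] nn_integral_dual_haar_ruelle[OF W dual F'] transfer ..
  also have "\<dots> = ennreal lam * (\<integral>\<^sup>+x. F' x \<partial>M)"
    using F' by (simp add: nn_integral_scale_measure measurable_cong_sets[OF sets_M refl])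
  \<comment> \<open>\<open>ennreal lam\<close> is neither zero nor infinite, so it cancels even if
    the integrals are infinite.\<close>
  finally have "(\<integral>\<^sup>+x. F x \<partial>M) = (\<integral>\<^sup>+x. F' x \<partial>M)"
    using lam by (simp add: ennreal_mult_cancel_left)
  then show ?thesis
    unfolding F_def F'_def .
qed

text \<open>Split \<open>h\<close> into positive and negative parts. Both are dominated by the
  absolute value of \<open>h\<close>, so all four integrals are finite and the differences can be
  taken.\<close>

lemma integral_quasi_invariant:
  fixes h :: "seq \<times> seq \<Rightarrow> real"
  assumes W: "continuous_on (shift_space d) W"
    and lam: "lam > 0"
    and dual: "dual_image (shift_space d) (haar_ruelle d G W) M (scale_measure (ennreal lam) M)"
    and h: "h \<in> borel_measurable (restrict_space borel G)"
    and int: "integrable M (\<lambda>x. \<Sum>s\<in>G `` {x}. \<bar>h (s, x)\<bar>)"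
    and int': "integrable M (\<lambda>x. \<Sum>s\<in>G `` {x}. \<bar>h (x, s)\<bar> * exp (W s - W x))"
  shows "(\<integral>x. (\<Sum>s\<in>G `` {x}. h (s, x)) \<partial>M) = (\<integral>x. (\<Sum>s\<in>G `` {x}. h (x, s) * exp (W s - W x)) \<partial>M)"
proof -
  let ?S = "restrict_space borel (shift_space d)"
  have W': "W \<in> borel_measurable ?S"
    using W by (rule borel_measurable_continuous_on_restrict)
  have sets_M: "sets M = sets ?S"
    using dual by (simp add: dual_image_def finite_borel_measure_on_def)
  have meas: "(\<lambda>x. \<Sum>s\<in>G `` {x}. g (s, x)) \<in> borel_measurable M"
      "(\<lambda>x. \<Sum>s\<in>G `` {x}. g (x, s) * exp (W s - W x)) \<in> borel_measurable M"
    if g: "g \<in> borel_measurable (restrict_space borel G)" for g :: "seq \<times> seq \<Rightarrow> real"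
  proof -
    have "(\<lambda>p. g p * exp (W (snd p) - W (fst p))) \<in> borel_measurable (restrict_space borel G)"
      by (intro borel_measurable_times g measurable_compose[OF _ borel_measurable_exp] borel_measurable_diff
          measurable_fst_class[OF W'] measurable_snd_class[OF W'])
    from borel_measurable_class_sum[OF this] borel_measurable_class_sum[OF measurable_swap_class[OF g]]
    show "(\<lambda>x. \<Sum>s\<in>G `` {x}. g (s, x)) \<in> borel_measurable M"
      "(\<lambda>x. \<Sum>s\<in>G `` {x}. g (x, s) * exp (W s - W x)) \<in> borel_measurable M"
      by (simp_all add: measurable_cong_sets[OF sets_M refl])
  qed
  \<comment> \<open>For nonnegative measurable integrands the Bochner integral is the real part of
    the \<open>ennreal\<close> integral, with value \<open>0\<close> on both sides if that is
    infinite.\<close>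
  have nonneg: "(\<integral>x. (\<Sum>s\<in>G `` {x}. g (s, x)) \<partial>M) =
      (\<integral>x. (\<Sum>s\<in>G `` {x}. g (x, s) * exp (W s - W x)) \<partial>M)"
    if g: "g \<in> borel_measurable (restrict_space borel G)" and g0: "\<And>p. 0 \<le> g p" for g :: "seq \<times> seq \<Rightarrow> real"
  proof -
    have "(\<integral>\<^sup>+x. ennreal (\<Sum>s\<in>G `` {x}. g (s, x)) \<partial>M) =
        (\<integral>\<^sup>+x. ennreal (\<Sum>s\<in>G `` {x}. g (x, s) * exp (W s - W x)) \<partial>M)"
      using nn_integral_quasi_invariant[OF W lam dual, of "\<lambda>p. ennreal (g p)"] g g0
      by (simp add: sum_nonneg flip: ennreal_mult)
    then show ?thesis
      using g0 by (simp add: integral_eq_nn_integral meas[OF g] sum_nonneg)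
  qed
  define p where "p = (\<lambda>q. max 0 (h q))"
  define n where "n = (\<lambda>q. max 0 (- h q))"
  have p: "p \<in> borel_measurable (restrict_space borel G)" "\<And>q. 0 \<le> p q" "\<And>q. p q \<le> \<bar>h q\<bar>"
    and n: "n \<in> borel_measurable (restrict_space borel G)" "\<And>q. 0 \<le> n q" "\<And>q. n q \<le> \<bar>h q\<bar>"
    using h by (auto simp: p_def n_def)
  have h_eq: "h q = p q - n q" for q
    by (auto simp: p_def n_def)
  have part_int: "integrable M (\<lambda>x. \<Sum>s\<in>G `` {x}. g (s, x))"
      "integrable M (\<lambda>x. \<Sum>s\<in>G `` {x}. g (x, s) * exp (W s - W x))"
    if g: "g \<in> borel_measurable (restrict_space borel G)" "\<And>q. 0 \<le> g q" "\<And>q. g q \<le> \<bar>h q\<bar>"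
    for g :: "seq \<times> seq \<Rightarrow> real"
  proof -
    show "integrable M (\<lambda>x. \<Sum>s\<in>G `` {x}. g (s, x))"
      using g by (intro Bochner_Integration.integrable_bound[OF int] meas)
        (auto intro!: AE_I2 sum_mono simp: abs_of_nonneg sum_nonneg)
    show "integrable M (\<lambda>x. \<Sum>s\<in>G `` {x}. g (x, s) * exp (W s - W x))"
      using g by (intro Bochner_Integration.integrable_bound[OF int'] meas)
        (auto intro!: AE_I2 sum_mono simp: abs_of_nonneg sum_nonneg)
  qed
  show ?thesis
    unfolding h_eq left_diff_distrib sum_subtractf
      Bochner_Integration.integral_diff[OF part_int(1)[OF p] part_int(1)[OF n]]
      Bochner_Integration.integral_diff[OF part_int(2)[OF p] part_int(2)[OF n]]
      nonneg[OF p(1,2)] nonneg[OF n(1,2)] ..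
qed

end

theorem theorem3p5:
  fixes d :: nat and G :: "(seq \<times> seq) set" and V :: "seq \<Rightarrow> real"
    and \<beta> lam :: real and M :: "seq measure"
  assumes "d \<ge> 1"
    and "equiv (shift_space d) G"
    and "\<forall>x\<in>shift_space d. finite (G `` {x})"
    and "hemicontinuous_on (shift_space d) (\<lambda>x. G `` {x}) (shift_space d)"
    and "continuous_symbolic d G"
    and "\<beta> > 0"
    and "continuous_on (shift_space d) V"
    and "finite_borel_measure_on (shift_space d) M"
    and "lam > 0"
    and "dual_image (shift_space d) (haar_ruelle d G (\<lambda>s. - \<beta> * V s)) M
           (scale_measure (ennreal lam) M)"
  shows "quasi_invariant G (separable_cocycle V) \<beta> M"
proof -
  have "\<exists>\<psi>. class_listing d G \<psi>"
    using assms(5) unfolding continuous_symbolic_def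
    by (elim exE conjE)
      (rule exI, rule class_listing.intro[OF assms(2)], erule (1) bspec,
        drule spec, erule (1) mp)
  then obtain \<psi> where "class_listing d G \<psi>" ..
  then interpret class_listing d G \<psi> .
  have W: "continuous_on (shift_space d) (\<lambda>s. - \<beta> * V s)"
    using assms(7) by (intro continuous_intros)
  \<comment> \<open>Separability writes the cocycle exponent as \<open>W s - W x\<close> with
    \<open>W = - \<beta> V\<close>.\<close>
  have exponent: "- \<beta> * separable_cocycle V (x, s) = - \<beta> * V s - - \<beta> * V x" for x s
    by (simp add: separable_cocycle_def algebra_simps)
  show ?thesis
    unfolding quasi_invariant_def exponent
    by (intro ballI impI integral_quasi_invariant[OF W assms(9,10)])
qed

end
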